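(* Let $$X=\{(x,y,t)\in\{0,1\}^2\times\mathbb{R}^2\times\mathbb{R} : (y_1-y_2)^2\le t,\ 0\le y_i\le x_i,\ i=1,2\}.$$ Then $$\operatorname{conv}(X)=\{(x,y,t)\in[0,1]^2\times\mathbb{R}_+^3 : g(x,y)\le t,\ y_i\le x_i,\ i=1,2\},$$ where $$g(x,y)=\begin{cases}\dfrac{(y_1-x_2)^2}{x_1-x_2}+\dfrac{(x_2-y_2)^2}{x_2} & \text{if } y_2\le x_2\le y_1 \text{ and } x_2(x_1-y_1)\le y_2(x_1-x_2),\\[2mm] \dfrac{(y_2-x_1)^2}{x_2-x_1}+\dfrac{(x_1-y_1)^2}{x_1} & \text{if } y_1\le x_1\le y_2 \text{ and } x_1(x_2-y_2)\le y_1(x_2-x_1),\\[2mm] f(x,y) & \text{otherwise,}\end{cases}$$ and $$f(x,y)=\begin{cases}\dfrac{(y_1-y_2)^2}{x_1} & \text{if } y_1\ge y_2,\\[2mm] \dfrac{(y_2-y_1)^2}{x_2} & \text{if } y_1\le y_2.\end{cases}$$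
   Context: Convention for division by zero: $0/0=0$ and $a/0=\infty$ for $a>0$. $\operatorname{conv}$ denotes the convex hull. The function $g$ is only evaluated at points with $0\le y_i\le x_i\le 1$, $i=1,2$. *)

theory Defs
  imports "HOL-Analysis.Analysis"
begin

text \<open>
  The quotients below are taken in \<^typ>\<open>ereal\<close>, because its division follows the convention
  \<open>0/0 = 0\<close> and \<open>a/0 = \<infinity>\<close> for \<open>a > 0\<close>; see \<open>quot_zero_zero\<close> and \<open>quot_pos_zero\<close>.
\<close>

lemma quot_zero_zero: "ereal 0 / ereal 0 = 0"
  by (simp add: divide_ereal_def)

lemma quot_pos_zero: "a > 0 \<Longrightarrow> ereal a / ereal 0 = \<infinity>"
  by (simp add: divide_ereal_def)

definition X_set :: "((real ^ 2) \<times> (real ^ 2) \<times> real) set" where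
  "X_set = {(x, y, t). (\<forall>i. x $ i \<in> {0, 1}) \<and> (y $ 1 - y $ 2)\<^sup>2 \<le> t \<and>
                       (\<forall>i. 0 \<le> y $ i \<and> y $ i \<le> x $ i)}"

text \<open>The two cases of \<open>f_fun\<close> agree (both are 0) when \<open>y $ 1 = y $ 2\<close>.\<close>

definition f_fun :: "real ^ 2 \<Rightarrow> real ^ 2 \<Rightarrow> ereal" where
  "f_fun x y =
    (if y $ 1 \<ge> y $ 2 then ereal ((y $ 1 - y $ 2)\<^sup>2) / ereal (x $ 1)
     else ereal ((y $ 2 - y $ 1)\<^sup>2) / ereal (x $ 2))"

text \<open>
  Only the values of \<open>g_fun\<close> at points with \<open>0 \<le> y $ i \<le> x $ i \<le> 1\<close> matter. There the
  denominators of the selected case are nonnegative, and if the conditions of the first two cases hold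
  simultaneously, then all four coordinates coincide and both formulas give 0.
\<close>

definition g_fun :: "real ^ 2 \<Rightarrow> real ^ 2 \<Rightarrow> ereal" where
  "g_fun x y =
    (if y $ 2 \<le> x $ 2 \<and> x $ 2 \<le> y $ 1 \<and>
        x $ 2 * (x $ 1 - y $ 1) \<le> y $ 2 * (x $ 1 - x $ 2)
     then ereal ((y $ 1 - x $ 2)\<^sup>2) / ereal (x $ 1 - x $ 2) +
          ereal ((x $ 2 - y $ 2)\<^sup>2) / ereal (x $ 2)
     else if y $ 1 \<le> x $ 1 \<and> x $ 1 \<le> y $ 2 \<and>
        x $ 1 * (x $ 2 - y $ 2) \<le> y $ 1 * (x $ 2 - x $ 1)
     then ereal ((y $ 2 - x $ 1)\<^sup>2) / ereal (x $ 2 - x $ 1) +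
          ereal ((x $ 1 - y $ 1)\<^sup>2) / ereal (x $ 1)
     else f_fun x y)"

end

theory Submission
  imports Defs
begin

text \<open>
  Both sides are compared one ordering of the coordinates at a time, say \<open>y\<^sub>j \<le> y\<^sub>i\<close>.
  Applying \<open>u\<^sup>2 \<ge> 2 s u - s\<^sup>2\<close> with slopes \<open>0 \<le> s\<^sub>2 \<le> s\<^sub>1 \<le> 1\<close> on the parts of the hull that
  lie over \<open>(1,0)\<close> and \<open>(1,1)\<close> gives the linear inequality
  \<open>t \<ge> 2 s\<^sub>1 (y\<^sub>i - x\<^sub>j) - s\<^sub>1\<^sup>2 (x\<^sub>i - x\<^sub>j) + 2 s\<^sub>2 (x\<^sub>j - y\<^sub>j) - s\<^sub>2\<^sup>2 x\<^sub>j\<close>, valid on \<open>X\<close>.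
  The slopes \<open>(y\<^sub>i - x\<^sub>j) / (x\<^sub>i - x\<^sub>j)\<close> and \<open>(x\<^sub>j - y\<^sub>j) / x\<^sub>j\<close> turn it into \<open>g \<le> t\<close>
  in the first case of \<open>g\<close>, whose second condition says precisely that they are ordered; the equal
  slopes \<open>(y\<^sub>i - y\<^sub>j) / x\<^sub>i\<close> turn it into \<open>f \<le> t\<close>.
  Conversely, \<open>g\<close> is attained by an explicit convex combination that puts the largest possible weight
  \<open>min x\<^sub>i x\<^sub>j\<close> on \<open>(1,1)\<close>.
\<close>

lemma ereal_divide_ereal:
  assumes "b = 0 \<Longrightarrow> a = 0"
  shows "ereal a / ereal b = ereal (a / b)"
  using assms by (cases "b = 0") (auto simp: divide_ereal_def divide_inverse)

section \<open>Linear inequalities valid on the hull\<close>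

lemma linear_le_convex_hull:
  fixes h :: "'a::real_vector \<Rightarrow> real"
  assumes "linear h" and "\<And>z. z \<in> S \<Longrightarrow> h z \<le> b" and "z \<in> convex hull S"
  shows "h z \<le> b"
proof -
  have "convex (h -` {..b})"
    by (rule convex_linear_vimage) (use assms(1) in auto)
  then have "convex hull S \<subseteq> h -` {..b}"
    by (rule hull_minimal[rotated]) (use assms(2) in auto)
  then show ?thesis using assms(3) by auto
qed

text \<open>With the coordinates named by distinct \<open>i\<close> and \<open>j\<close>, one
  argument serves both orderings.\<close>

lemma X_set_iff:
  fixes i j :: 2
  assumes "i \<noteq> j"
  shows "(x, y, t) \<in> X_set \<longleftrightarrow> x $ i \<in> {0, 1} \<and> x $ j \<in> {0, 1} \<and> (y $ i - y $ j)\<^sup>2 \<le> t \<and>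
    0 \<le> y $ i \<and> y $ i \<le> x $ i \<and> 0 \<le> y $ j \<and> y $ j \<le> x $ j"
  using assms exhaust_2[of i] exhaust_2[of j]
  by (auto simp: X_set_def forall_2 power2_commute)

lemma convex_hull_X_set_bounds:
  assumes "(x, y, t) \<in> convex hull X_set"
  shows "0 \<le> y $ k" "y $ k \<le> x $ k" "x $ k \<le> 1" "0 \<le> t"
proof -
  have "- y $ k \<le> 0"
    by (rule linear_le_convex_hull[where h = "\<lambda>(x, y, t). - y $ k", OF _ _ assms, simplified])
       (auto intro!: linearI simp: X_set_def)
  then show "0 \<le> y $ k" by simp
  have "y $ k - x $ k \<le> 0"
    by (rule linear_le_convex_hull[where h = "\<lambda>(x, y, t). y $ k - x $ k", OF _ _ assms, simplified])
       (auto intro!: linearI simp: X_set_def algebra_simps)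
  then show "y $ k \<le> x $ k" by simp
  show "x $ k \<le> 1"
    by (rule linear_le_convex_hull[where h = "\<lambda>(x, y, t). x $ k", OF _ _ assms, simplified])
       (auto intro!: linearI simp: X_set_def, metis order_refl zero_le_one)
  have "- t \<le> 0"
    by (rule linear_le_convex_hull[where h = "\<lambda>(x, y, t). - t", OF _ _ assms, simplified])
       (auto intro!: linearI simp: X_set_def intro: order_trans[OF zero_le_power2])
  then show "0 \<le> t" by simp
qed

lemma tangent_le_X_set:
  fixes i j :: 2
  assumes "(x, y, t) \<in> X_set" "i \<noteq> j" "0 \<le> s2" "s2 \<le> s1" "s1 \<le> 1"
  shows "2 * s1 * (y $ i - x $ j) - s1\<^sup>2 * (x $ i - x $ j) + 2 * s2 * (x $ j - y $ j) - s2\<^sup>2 * x $ j \<le> t"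
proof -
  have t: "(y $ i - y $ j)\<^sup>2 \<le> t" and y: "0 \<le> y $ i" "y $ i \<le> x $ i" "0 \<le> y $ j" "y $ j \<le> x $ j"
    and x: "x $ i \<in> {0, 1}" "x $ j \<in> {0, 1}"
    using assms(1) X_set_iff[OF assms(2)] by auto
  consider "x $ i = 0" "x $ j = 0" | "x $ i = 1" "x $ j = 0" | "x $ i = 0" "x $ j = 1"
    | "x $ i = 1" "x $ j = 1"
    using x by auto
  then show ?thesis
  proof cases
    case 1
    then show ?thesis using y t by auto
  next
    case 2
    have "0 \<le> (y $ i - s1)\<^sup>2" by simp
    then show ?thesis using 2 y t by (auto simp: power2_eq_square algebra_simps)
  next
    case 3
    \<comment> \<open>Over (0,1) the left side is
      \<open>- (s1 - s2) * (2 - s1 - s2) - 2 * s2 * y $ j\<close>.\<close>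
    have "0 \<le> (s1 - s2) * (2 - s1 - s2)" "0 \<le> s2 * y $ j"
      using assms y by (auto intro!: mult_nonneg_nonneg)
    moreover have "0 \<le> t" using t zero_le_power2 order_trans by blast
    ultimately show ?thesis using 3 y by (auto simp: power2_eq_square algebra_simps)
  next
    case 4
    \<comment> \<open>The left side is the tangent of slope \<open>s2\<close> at
      \<open>y $ i - y $ j\<close>, less \<open>2 * (s1 - s2) * (1 - y $ i)\<close>.\<close>
    have "0 \<le> (y $ i - y $ j - s2)\<^sup>2" by simp
    moreover have "0 \<le> (s1 - s2) * (1 - y $ i)"
      using assms y 4 by (auto intro!: mult_nonneg_nonneg)
    ultimately show ?thesis using 4 t by (auto simp: power2_eq_square algebra_simps)
  qed
qed

lemma tangent_le_convex_hull_X_set: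
  fixes i j :: 2
  assumes "(x, y, t) \<in> convex hull X_set" "i \<noteq> j" "0 \<le> s2" "s2 \<le> s1" "s1 \<le> 1"
  shows "2 * s1 * (y $ i - x $ j) - s1\<^sup>2 * (x $ i - x $ j) + 2 * s2 * (x $ j - y $ j) - s2\<^sup>2 * x $ j \<le> t"
proof -
  define h :: "(real ^ 2) \<times> (real ^ 2) \<times> real \<Rightarrow> real" where
    "h = (\<lambda>(x, y, t). 2 * s1 * (y $ i - x $ j) - s1\<^sup>2 * (x $ i - x $ j)
      + 2 * s2 * (x $ j - y $ j) - s2\<^sup>2 * x $ j - t)"
  have "h (x, y, t) \<le> 0"
  proof (rule linear_le_convex_hull[OF _ _ assms(1)])
    show "linear h"
      unfolding h_def by (auto intro!: linearI simp: algebra_simps)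
    show "h z \<le> 0" if "z \<in> X_set" for z
      using that tangent_le_X_set[OF _ assms(2-5)] by (cases z) (auto simp: h_def)
  qed
  then show ?thesis by (simp add: h_def)
qed

section \<open>Explicit points of the hull\<close>

lemma convex_combination_in_convex_hull_X_set:
  fixes i j :: 2
  assumes "i \<noteq> j"
    and q: "0 \<le> q00" "0 \<le> q10" "0 \<le> q01" "0 \<le> q11" "q00 + q10 + q01 + q11 = 1"
    and u: "0 \<le> u" "u \<le> 1" "0 \<le> v" "v \<le> 1" "0 \<le> w" "w \<le> 1"
    and x: "x $ i = q10 + q11" "x $ j = q01 + q11"
    and y: "y $ i = q10 * u + q11 * v" "y $ j = q11 * w"
    and t: "q10 * u\<^sup>2 + q11 * (v - w)\<^sup>2 \<le> t"
  shows "(x, y, t) \<in> convex hull X_set"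
proof -
  define vec :: "real \<Rightarrow> real \<Rightarrow> real ^ 2" where "vec = (\<lambda>a b. \<chi> k. if k = i then a else b)"
  have vec: "vec a b $ i = a" "vec a b $ j = b" for a b
    using assms(1) by (auto simp: vec_def)
  have eq: "a = b" if "a $ i = b $ i" "a $ j = b $ j" for a b :: "real ^ 2"
    using that assms(1) exhaust_2[of i] exhaust_2[of j] by (auto simp: vec_eq_iff forall_2)
  \<comment> \<open>Raising all four points by the same slack makes their average exactly
    \<open>t\<close>.\<close>
  define r where "r = t - (q10 * u\<^sup>2 + q11 * (v - w)\<^sup>2)"
  have r: "0 \<le> r" using t by (simp add: r_def)
  define z00 where "z00 = (vec 0 0, vec 0 0, r)"
  define z10 where "z10 = (vec 1 0, vec u 0, u\<^sup>2 + r)"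
  define z01 where "z01 = (vec 0 1, vec 0 0, r)"
  define z11 where "z11 = (vec 1 1, vec v w, (v - w)\<^sup>2 + r)"
  note z = z00_def z10_def z01_def z11_def
  have in_X: "{z00, z10, z01, z11} \<subseteq> X_set"
    using u r by (auto simp: z X_set_iff[OF assms(1)] vec)
  have "q00 * r + q10 * (u\<^sup>2 + r) + q01 * r + q11 * ((v - w)\<^sup>2 + r)
      = (q00 + q10 + q01 + q11) * r + (q10 * u\<^sup>2 + q11 * (v - w)\<^sup>2)"
    by (simp add: algebra_simps)
  also have "\<dots> = t" using q(5) by (simp add: r_def)
  finally have "(x, y, t) = q00 *\<^sub>R z00 + q10 *\<^sub>R z10 + q01 *\<^sub>R z01 + q11 *\<^sub>R z11"
    by (auto simp: z x y vec intro!: eq)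
  also have "\<dots> \<in> convex hull X_set"
  proof -
    have hull: "z00 \<in> convex hull X_set" "z10 \<in> convex hull X_set" "z01 \<in> convex hull X_set"
      "z11 \<in> convex hull X_set"
      using in_X hull_subset[of X_set convex] by auto
    define c where "c = (\<lambda>k::nat. [q00, q10, q01, q11] ! k)"
    define p where "p = (\<lambda>k::nat. [z00, z10, z01, z11] ! k)"
    have "(\<Sum>k\<in>{0,1,2,3}. c k *\<^sub>R p k) \<in> convex hull X_set"
      by (rule convex_sum) (use q hull in \<open>auto simp: c_def p_def\<close>)
    then show ?thesis by (simp add: c_def p_def add.assoc)
  qed
  finally show ?thesis .
qed

text \<open>The real value of \<open>g\<close> when \<open>y $ j \<le> y $ i\<close>: no infinite quotient occurs on the domain, and
  \<open>a / 0 = 0\<close> on the reals is harmless since all numerators over \<open>0\<close> vanish.\<close>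

definition g_real :: "2 \<Rightarrow> 2 \<Rightarrow> real ^ 2 \<Rightarrow> real ^ 2 \<Rightarrow> real" where
  "g_real i j x y =
    (if x $ j \<le> y $ i \<and> x $ j * (x $ i - y $ i) \<le> y $ j * (x $ i - x $ j)
     then (y $ i - x $ j)\<^sup>2 / (x $ i - x $ j) + (x $ j - y $ j)\<^sup>2 / x $ j
     else (y $ i - y $ j)\<^sup>2 / x $ i)"

lemma g_fun_eq_g_real_1_2:
  assumes "\<And>k. 0 \<le> y $ k" "\<And>k. y $ k \<le> x $ k" "y $ 2 \<le> y $ 1"
  shows "g_fun x y = ereal (g_real 1 2 x y)"
proof -
  have b: "0 \<le> y $ 1" "0 \<le> y $ 2" "y $ 1 \<le> x $ 1" "y $ 2 \<le> x $ 2"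
    using assms by auto
  show ?thesis
  proof (cases "x $ 2 \<le> y $ 1 \<and> x $ 2 * (x $ 1 - y $ 1) \<le> y $ 2 * (x $ 1 - x $ 2)")
    case True
    then show ?thesis using b
      by (simp add: g_fun_def g_real_def ereal_divide_ereal)
  next
    case no: False
    have f: "f_fun x y = ereal ((y $ 1 - y $ 2)\<^sup>2 / x $ 1)"
      using b assms(3) unfolding f_fun_def by (simp add: ereal_divide_ereal)
    show ?thesis
    proof (cases "x $ 1 \<le> y $ 2")
      case True
      \<comment> \<open>The second case of \<open>g_fun\<close> meets this ordering only here, where
        it and \<open>f_fun\<close> both give 0.\<close>
      then have "y $ 1 = x $ 1" "y $ 2 = x $ 1" using b assms(3) by auto
      then show ?thesis using f unfolding g_fun_def g_real_def if_not_P[OF no] by simp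
    next
      case False
      then show ?thesis using no f by (auto simp: g_fun_def g_real_def)
    qed
  qed
qed

lemma g_fun_eq_g_real_2_1:
  assumes "\<And>k. 0 \<le> y $ k" "\<And>k. y $ k \<le> x $ k" "y $ 1 \<le> y $ 2"
  shows "g_fun x y = ereal (g_real 2 1 x y)"
proof -
  have b: "0 \<le> y $ 1" "0 \<le> y $ 2" "y $ 1 \<le> x $ 1" "y $ 2 \<le> x $ 2"
    using assms by auto
  show ?thesis
  proof (cases "y $ 1 = y $ 2")
    case True
    \<comment> \<open>On a tie \<open>g_fun\<close> may select its first case, so the value comes
      from the other ordering.\<close>
    then have "g_fun x y = ereal (g_real 1 2 x y)"
      by (intro g_fun_eq_g_real_1_2 assms) simp
    also have "g_real 1 2 x y = 0" "g_real 2 1 x y = 0"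
      using b True by (auto simp: g_real_def)
    ultimately show ?thesis by simp
  next
    case False
    then have lt: "y $ 1 < y $ 2" using assms(3) by simp
    then have "\<not> x $ 2 \<le> y $ 1" using b by simp
    then show ?thesis
      using b lt by (simp add: g_fun_def g_real_def f_fun_def ereal_divide_ereal)
  qed
qed

text \<open>For \<open>b > 0\<close> the slope \<open>a / b\<close> maximizes
  \<open>2 * s * a - s\<^sup>2 * b\<close> over \<open>s\<close>, so it gives the strongest tangent
  inequality.\<close>

lemma two_mult_quotient_minus_square:
  fixes a b :: real
  assumes "b = 0 \<Longrightarrow> a = 0"
  shows "2 * (a / b) * a - (a / b)\<^sup>2 * b = a\<^sup>2 / b"
  using assms by (cases "b = 0") (auto simp: power2_eq_square)

lemma g_real_le_if_in_convex_hull_X_set: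
  fixes i j :: 2
  assumes "(x, y, t) \<in> convex hull X_set" "i \<noteq> j" "y $ j \<le> y $ i"
  shows "g_real i j x y \<le> t"
proof -
  note bounds = convex_hull_X_set_bounds[OF assms(1)]
  note b = bounds(1)[of i] bounds(1)[of j] bounds(2)[of i] bounds(2)[of j]
  note tangent = tangent_le_convex_hull_X_set[OF assms(1,2)]
  show ?thesis
  proof (cases "x $ j \<le> y $ i \<and> x $ j * (x $ i - y $ i) \<le> y $ j * (x $ i - x $ j)")
    case True
    \<comment> \<open>If \<open>x $ i = x $ j\<close>, then \<open>y $ i = x $ j\<close> and the
      terms in \<open>s1\<close> vanish; the value 1 keeps \<open>s2 \<le> s1\<close>.\<close>
    define s1 where "s1 = (if x $ i = x $ j then 1 else (y $ i - x $ j) / (x $ i - x $ j))"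
    define s2 where "s2 = (x $ j - y $ j) / x $ j"
    have s1: "0 \<le> s1" "s1 \<le> 1" and s2: "0 \<le> s2" "s2 \<le> 1"
      using True b by (auto simp: s1_def s2_def divide_le_eq_1)
    have "s2 \<le> s1"
    proof (cases "x $ i = x $ j \<or> x $ j = 0")
      case True
      then show ?thesis using s1 s2 by (auto simp: s1_def s2_def)
    next
      case False
      then have "0 < x $ j" "0 < x $ i - x $ j" using True b by auto
      then show ?thesis
        using True by (simp add: s1_def s2_def divide_simps algebra_simps)
    qed
    then have "2 * s1 * (y $ i - x $ j) - s1\<^sup>2 * (x $ i - x $ j)
        + (2 * s2 * (x $ j - y $ j) - s2\<^sup>2 * x $ j) \<le> t"
      using tangent[of s2 s1] s1 s2 by simp
    moreover have "2 * s1 * (y $ i - x $ j) - s1\<^sup>2 * (x $ i - x $ j)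
        = (y $ i - x $ j)\<^sup>2 / (x $ i - x $ j)"
      using True b two_mult_quotient_minus_square[of "x $ i - x $ j" "y $ i - x $ j"]
      by (auto simp: s1_def)
    moreover have "2 * s2 * (x $ j - y $ j) - s2\<^sup>2 * x $ j = (x $ j - y $ j)\<^sup>2 / x $ j"
      unfolding s2_def by (rule two_mult_quotient_minus_square) (use b in simp)
    ultimately show ?thesis using True by (simp add: g_real_def)
  next
    case False
    define s where "s = (y $ i - y $ j) / x $ i"
    have "0 \<le> s" "s \<le> 1"
      using b assms(3) by (auto simp: s_def divide_le_eq_1)
    \<comment> \<open>With equal slopes the terms in \<open>x $ j\<close> cancel.\<close>
    then have "2 * s * (y $ i - y $ j) - s\<^sup>2 * x $ i \<le> t"
      using tangent[of s s] by (simp add: algebra_simps)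
    moreover have "2 * s * (y $ i - y $ j) - s\<^sup>2 * x $ i = (y $ i - y $ j)\<^sup>2 / x $ i"
      unfolding s_def by (rule two_mult_quotient_minus_square) (use b assms(3) in simp)
    ultimately show ?thesis using False by (auto simp: g_real_def)
  qed
qed

lemma in_convex_hull_X_set_if_g_real_le:
  fixes i j :: 2
  assumes "i \<noteq> j" "y $ j \<le> y $ i" "g_real i j x y \<le> t"
    and b: "0 \<le> y $ i" "0 \<le> y $ j" "y $ i \<le> x $ i" "y $ j \<le> x $ j" "x $ i \<le> 1" "x $ j \<le> 1"
  shows "(x, y, t) \<in> convex hull X_set"
proof (cases "x $ j \<le> y $ i \<and> x $ j * (x $ i - y $ i) \<le> y $ j * (x $ i - x $ j)")
  case True
  \<comment> \<open>Over (1,1) the \<open>i\<close>-th entry is saturated at 1; \<open>u\<close> and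
    \<open>w\<close> are then forced by the averages wherever the weights are positive.\<close>
  define u where "u = (y $ i - x $ j) / (x $ i - x $ j)"
  define w where "w = y $ j / x $ j"
  have u: "(x $ i - x $ j) * u = y $ i - x $ j" "0 \<le> u" "u \<le> 1"
    "(x $ i - x $ j) * u\<^sup>2 = (y $ i - x $ j)\<^sup>2 / (x $ i - x $ j)"
    using True b by (auto simp: u_def divide_le_eq_1 power2_eq_square)
  have w: "x $ j * w = y $ j" "0 \<le> w" "w \<le> 1"
    using b by (auto simp: w_def divide_le_eq_1)
  have sq: "x $ j * (1 - w)\<^sup>2 = (x $ j - y $ j)\<^sup>2 / x $ j"
    using b by (cases "x $ j = 0") (auto simp: w_def field_simps power2_eq_square)
  show ?thesis
    by (rule convex_combination_in_convex_hull_X_set[OF assms(1), where ?q00.0 = "1 - x $ i" and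
          ?q10.0 = "x $ i - x $ j" and ?q01.0 = 0 and ?q11.0 = "x $ j" and u = u and v = 1 and w = w])
       (use True b u w sq assms(3) in \<open>auto simp: g_real_def\<close>)
next
  case False
  define p where "p = min (x $ i) (x $ j)"
  \<comment> \<open>The difference of the entries is \<open>s\<close> over both (1,0) and (1,1), at
    total cost \<open>x $ i * s\<^sup>2\<close>.\<close>
  define s where "s = (y $ i - y $ j) / x $ i"
  define w where "w = y $ j / p"
  have p: "0 \<le> p" "p \<le> x $ i" "p \<le> x $ j" "y $ j \<le> p"
    using b assms(2) by (auto simp: p_def)
  have s: "x $ i * s = y $ i - y $ j" "0 \<le> s" "s \<le> 1" "x $ i * s\<^sup>2 = (y $ i - y $ j)\<^sup>2 / x $ i"
    using assms(2) b by (auto simp: s_def divide_le_eq_1 power2_eq_square)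
  have w: "p * w = y $ j" "0 \<le> w" "w \<le> 1"
    using p b by (auto simp: w_def divide_le_eq_1)
  \<comment> \<open>This is the bound \<open>v \<le> 1\<close> over (1,1), the only one that needs
    the failure of the first case.\<close>
  have "w + s \<le> 1"
  proof (cases "p = 0")
    case True
    then show ?thesis using s by (simp add: w_def)
  next
    case p0: False
    then have pos: "0 < p" "0 < x $ i" using p by auto
    have "y $ j * x $ i \<le> p * (x $ i - y $ i + y $ j)"
    proof (cases "x $ i \<le> x $ j")
      case True
      have "0 \<le> x $ i * (x $ i - y $ i)" using b by (intro mult_nonneg_nonneg) auto
      with True show ?thesis by (simp add: p_def algebra_simps)
    next
      case lt: False
      \<comment> \<open>Either the second condition of the first case fails, or
        \<open>y $ i < x $ j\<close> and the factors compare one by one.\<close>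
      have "y $ j * (x $ i - x $ j) \<le> x $ j * (x $ i - y $ i)"
      proof (cases "x $ j \<le> y $ i")
        case True
        with False show ?thesis by simp
      next
        case False
        then show ?thesis using lt b by (intro mult_mono) auto
      qed
      then show ?thesis using lt by (simp add: p_def algebra_simps)
    qed
    then show ?thesis using pos by (simp add: w_def s_def divide_simps algebra_simps)
  qed
  moreover have "(x $ i - p) * s + p * (w + s) = y $ i" "(x $ i - p) * s\<^sup>2 + p * s\<^sup>2 = x $ i * s\<^sup>2"
    using s(1) w(1) by (simp_all add: algebra_simps)
  ultimately show ?thesis
    by (intro convex_combination_in_convex_hull_X_set[OF assms(1), where ?q00.0 = "1 - max (x $ i) (x $ j)" and
          ?q10.0 = "x $ i - p" and ?q01.0 = "x $ j - p" and ?q11.0 = p and u = s and v = "w + s" and w = w])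
       (use False b p s w assms(3) in \<open>auto simp: g_real_def p_def\<close>)
qed

theorem theorem2:
  "convex hull X_set =
    {(x, y, t). (\<forall>i. x $ i \<in> {0..1}) \<and> (\<forall>i. 0 \<le> y $ i) \<and> 0 \<le> t \<and>
                g_fun x y \<le> ereal t \<and> (\<forall>i. y $ i \<le> x $ i)}"
proof -
  have "(x, y, t) \<in> convex hull X_set \<longleftrightarrow>
      (\<forall>i. x $ i \<in> {0..1}) \<and> (\<forall>i. 0 \<le> y $ i) \<and> 0 \<le> t \<and>
      g_fun x y \<le> ereal t \<and> (\<forall>i. y $ i \<le> x $ i)" (is "?L \<longleftrightarrow> ?R") for x y t
  proof
    assume ?L
    note b = convex_hull_X_set_bounds[OF this]
    have "g_fun x y \<le> ereal t"
    proof (cases "y $ 2 \<le> y $ 1")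
      case True
      then show ?thesis
        using g_fun_eq_g_real_1_2[of y x] g_real_le_if_in_convex_hull_X_set[OF \<open>?L\<close>, of 1 2] b
        by simp
    next
      case False
      then show ?thesis
        using g_fun_eq_g_real_2_1[of y x] g_real_le_if_in_convex_hull_X_set[OF \<open>?L\<close>, of 2 1] b
        by simp
    qed
    then show ?R using b by (auto intro: order_trans)
  next
    assume R: ?R
    show ?L
    proof (cases "y $ 2 \<le> y $ 1")
      case True
      then show ?thesis
        using R g_fun_eq_g_real_1_2[of y x] in_convex_hull_X_set_if_g_real_le[of 1 2 y x t] by simp
    next
      case False
      then show ?thesis
        using R g_fun_eq_g_real_2_1[of y x] in_convex_hull_X_set_if_g_real_le[of 2 1 y x t] by simp
    qed
  qed
  then show ?thesis by auto
qed

end
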